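(* For all positive integers $k,l$, $\operatorname{osat}_{\mathcal S}(1,l)=\operatorname{osat}_{\mathcal S}(k,1)=0$, and for integers $k,l\ge 2$, \[\operatorname{osat}_{\mathcal S}(k,l)=\min(2k+l-5,\;2l+k-5).\]
   Context: Sequences consist of distinct real numbers (equivalently, finite planar point sets with pairwise distinct $x$-coordinates and pairwise distinct $y$-coordinates, read in order of $x$-coordinate). A sequence $S$ is $(k,l)$-semisaturated if every sequence $S'$ of distinct reals containing $S$ as a proper subsequence contains an increasing subsequence of length $k$ or a decreasing subsequence of length $l$ that is not entirely contained in $S$. $\operatorname{osat}_{\mathcal S}(k,l)$ is the minimum length of a $(k,l)$-semisaturated sequence. *)

theory Defs
  imports Complex_Main "HOL-Library.Sublist" "HOL-Library.Extended_Nat"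
begin

definition semisaturated :: "nat \<Rightarrow> nat \<Rightarrow> real list \<Rightarrow> bool" where
  "semisaturated k l S \<longleftrightarrow>
     distinct S \<and>
     (\<forall>S'. distinct S' \<and> strict_subseq S S' \<longrightarrow>
        (\<exists>T. subseq T S' \<and> \<not> subseq T S \<and>
             (sorted_wrt (<) T \<and> length T = k \<or> sorted_wrt (>) T \<and> length T = l)))"

(* The infimum over enat of a nonempty set is attained, and over the empty set it is \<infinity>;
   so osat k l = enat n says that a semisaturated sequence exists and that n is the minimum. *)
definition osat :: "nat \<Rightarrow> nat \<Rightarrow> enat" where
  "osat k l = (INF S \<in> {S. semisaturated k l S}. enat (length S))"

end

theory Submission
  imports Defs
begin

text \<open>
  Upper bound: put increasing runs of length \<open>k - 2\<close> before and below, and after and above,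
  a decreasing run of length \<open>l - 1\<close>. A new point either forms a decreasing pair with every point
  of the middle run, or an increasing pair with one of them, and then one of the outer runs
  completes an increasing sequence of length \<open>k\<close>. Reversal exchanges the roles of \<open>k\<close> and \<open>l\<close>.

  Lower bound: insert a point at the very left and raise its height \<open>y\<close>. It needs
  an increasing sequence of length \<open>k - 1\<close> above \<open>y\<close> or a decreasing one of length \<open>l - 1\<close> below
  \<open>y\<close>; at the last height \<open>q\<close> where the former exists, both exist and meet at most in \<open>q\<close>.
  Sweeping at the very right gives a second threshold \<open>q'\<close>. If \<open>q \<le> q'\<close>, there are two decreasing
  sequences of length \<open>l - 1\<close>, separated by height, and an increasing one of length \<open>k - 1\<close>, which
  meets each of them at most once; if \<open>q > q'\<close>, the roles of \<open>k\<close> and \<open>l\<close> are exchanged.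
\<close>

section \<open>Semisaturation and reversal\<close>

lemma subseq_rev: "subseq xs ys \<Longrightarrow> subseq (rev xs) (rev ys)"
  by (induction rule: list_emb.induct) auto

lemma subseq_rev_iff: "subseq (rev xs) ys \<longleftrightarrow> subseq xs (rev ys)"
  using subseq_rev[of "rev xs" ys] subseq_rev[of xs "rev ys"] by auto

lemma subseq_set: "subseq xs ys \<Longrightarrow> set xs \<subseteq> set ys"
  by (induction rule: list_emb.induct) auto

lemma semisaturated_rev:
  assumes "semisaturated k l S"
  shows "semisaturated l k (rev S)"
  unfolding semisaturated_def
proof (intro conjI allI impI)
  show "distinct (rev S)"
    using assms by (simp add: semisaturated_def)
next
  fix S' assume "distinct S' \<and> strict_subseq (rev S) S'"
  then have "distinct (rev S')" "strict_subseq S (rev S')"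
    by (auto simp: strict_subseq_def subseq_rev_iff)
  then obtain T where T: "subseq T (rev S')" "\<not> subseq T S"
    "sorted_wrt (<) T \<and> length T = k \<or> sorted_wrt (>) T \<and> length T = l"
    using assms unfolding semisaturated_def by blast
  show "\<exists>T. subseq T S' \<and> \<not> subseq T (rev S) \<and>
      (sorted_wrt (<) T \<and> length T = l \<or> sorted_wrt (>) T \<and> length T = k)"
    by (rule exI[of _ "rev T"]) (use T in \<open>auto simp: subseq_rev_iff sorted_wrt_rev\<close>)
qed

lemma semisaturated_rev_iff: "semisaturated l k (rev S) \<longleftrightarrow> semisaturated k l S"
  by (metis semisaturated_rev rev_rev_ident)

lemma osat_le: "semisaturated k l S \<Longrightarrow> osat k l \<le> enat (length S)"
  unfolding osat_def by (rule INF_lower) simp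

lemma osat_commute_le: "osat k l \<le> osat l k"
  unfolding osat_def[of l k]
proof (rule INF_greatest)
  fix S assume "S \<in> {S. semisaturated l k S}"
  then show "osat k l \<le> enat (length S)"
    using osat_le[of k l "rev S"] by (simp add: semisaturated_rev_iff)
qed

text \<open>Inserting one new point suffices: a distinct proper supersequence has a value
  \<open>x\<close> outside \<open>S\<close>, and \<open>S\<close> splits around its position. A
  sequence through \<open>x\<close> is no subsequence of \<open>S\<close>.\<close>

lemma semisaturatedI:
  assumes "distinct S"
    and "\<And>S1 S2 x. S = S1 @ S2 \<Longrightarrow> x \<notin> set S \<Longrightarrow>
      \<exists>T. subseq T (S1 @ x # S2) \<and> x \<in> set T \<and>
        (sorted_wrt (<) T \<and> length T = k \<or> sorted_wrt (>) T \<and> length T = l)"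
  shows "semisaturated k l S"
  unfolding semisaturated_def
proof (intro conjI allI impI)
  fix S' assume S': "distinct S' \<and> strict_subseq S S'"
  then have sub: "subseq S S'" and ne: "S \<noteq> S'"
    by (auto simp: strict_subseq_def)
  have "set S \<noteq> set S'"
    using sub ne S' assms(1) by (metis distinct_card subseq_same_length)
  moreover have "set S \<subseteq> set S'"
    using sub by (auto dest: subseq_set)
  ultimately obtain x where x: "x \<in> set S'" "x \<notin> set S" by blast
  then obtain X Y where XY: "S' = X @ x # Y" by (meson split_list)
  from sub obtain S1 B where S1: "S = S1 @ B" "subseq S1 X" "subseq B (x # Y)"
    unfolding XY by (rule subseq_appendE)
  from S1 x have "subseq B Y"
    by (cases B) (auto simp: subseq_Cons2_iff split: if_splits)
  with S1 have "subseq (S1 @ x # B) S'"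
    unfolding XY by (intro list_emb_append_mono) auto
  moreover obtain T where "subseq T (S1 @ x # B)" "x \<in> set T"
    "sorted_wrt (<) T \<and> length T = k \<or> sorted_wrt (>) T \<and> length T = l"
    using assms(2)[OF S1(1) x(2)] by blast
  moreover from this have "\<not> subseq T S"
    using x(2) by (auto dest: subseq_set)
  ultimately have "subseq T S'" "\<not> subseq T S"
    "sorted_wrt (<) T \<and> length T = k \<or> sorted_wrt (>) T \<and> length T = l"
    by (blast intro: subseq_order.trans)+
  then show "\<exists>T. subseq T S' \<and> \<not> subseq T S \<and>
      (sorted_wrt (<) T \<and> length T = k \<or> sorted_wrt (>) T \<and> length T = l)"
    by blast
qed (rule assms(1))

section \<open>Upper bound\<close>

lemma osat_1_left: "osat 1 l = 0"
proof -
  have "semisaturated 1 l []"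
    by (rule semisaturatedI) (auto intro!: exI[of _ "[_]"])
  then show ?thesis
    using osat_le[of 1 l "[]"] by (simp flip: zero_enat_def)
qed

text \<open>Split \<open>M\<close> at the insertion place into \<open>A\<close> and
  \<open>B\<close>. Either \<open>x\<close> fits between them, giving a decreasing sequence of
  length \<open>l\<close>, or it forms an increasing pair with some \<open>q\<close>; then
  \<open>L @ [q, x]\<close> or \<open>x # q # U\<close> has length \<open>k\<close>.\<close>

lemma semisaturated_if_extendable:
  assumes "distinct S" "2 \<le> k" "1 \<le> l"
    and M: "subseq M S" "sorted_wrt (>) M" "length M = l - 1"
    and below: "\<And>q. q \<in> set M \<Longrightarrow>
      \<exists>L. subseq (L @ [q]) S \<and> sorted_wrt (<) (L @ [q]) \<and> length L = k - 2"
    and above: "\<And>q. q \<in> set M \<Longrightarrow>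
      \<exists>U. subseq (q # U) S \<and> sorted_wrt (<) (q # U) \<and> length U = k - 2"
  shows "semisaturated k l S"
proof (rule semisaturatedI)
  fix S1 S2 x assume S: "S = S1 @ S2" and x: "x \<notin> set S"
  have dist: "distinct (S1 @ S2)" using assms(1) S by simp
  from M(1) obtain A B where AB: "M = A @ B" "subseq A S1" "subseq B S2"
    unfolding S by (rule subseq_appendE)
  have AS: "set A \<subseteq> set S1" and BS: "set B \<subseteq> set S2"
    using AB by (auto dest: subseq_set)
  consider (dec) "\<forall>q\<in>set A. x < q" "\<forall>q\<in>set B. q < x"
    | (left) q where "q \<in> set A" "q < x"
    | (right) q where "q \<in> set B" "x < q"
    using AS BS x unfolding S by (metis Un_iff linorder_less_linear set_append subset_iff)
  then show "\<exists>T. subseq T (S1 @ x # S2) \<and> x \<in> set T \<and>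
      (sorted_wrt (<) T \<and> length T = k \<or> sorted_wrt (>) T \<and> length T = l)"
  proof cases
    case dec
    show ?thesis
      by (rule exI[of _ "A @ x # B"])
        (use dec AB M assms(3) in \<open>auto simp: sorted_wrt_append intro!: list_emb_append_mono\<close>)
  next
    case left
    then obtain L where L: "subseq (L @ [q]) S" "sorted_wrt (<) (L @ [q])" "length L = k - 2"
      using below AB by auto
    from L(1) obtain C D where CD: "L @ [q] = C @ D" "subseq C S1" "subseq D S2"
      unfolding S by (rule subseq_appendE)
    \<comment> \<open>\<open>q\<close> ends \<open>L @ [q]\<close> and lies in \<open>S1\<close>
      only, so all of \<open>L @ [q]\<close> precedes \<open>x\<close>.\<close>
    have "q \<notin> set S2" using left AS dist by auto
    then have "D = []"
      using CD subseq_set[OF CD(3)] by (cases D rule: rev_cases) auto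
    with CD have "subseq (L @ [q]) S1" by simp
    then have "subseq ((L @ [q]) @ [x]) (S1 @ x # S2)"
      by (intro list_emb_append_mono) auto
    then show ?thesis
      by (intro exI[of _ "(L @ [q]) @ [x]"])
        (use left L assms(2) in \<open>auto simp: sorted_wrt_append\<close>)
  next
    case right
    then obtain U where U: "subseq (q # U) S" "sorted_wrt (<) (q # U)" "length U = k - 2"
      using above AB by auto
    from U(1) obtain C D where CD: "q # U = C @ D" "subseq C S1" "subseq D S2"
      unfolding S by (rule subseq_appendE)
    have "q \<notin> set S1" using right BS dist by auto
    then have "C = []"
      using CD subseq_set[OF CD(2)] by (cases C) auto
    with CD have "subseq (q # U) S2" by simp
    then have "subseq ([] @ x # q # U) (S1 @ x # S2)"
      by (intro list_emb_append_mono) auto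
    then show ?thesis
      by (intro exI[of _ "x # q # U"]) (use right U assms(2) in auto)
  qed
qed (rule assms(1))

lemma osat_upper:
  assumes "2 \<le> k" "2 \<le> l"
  shows "osat k l \<le> enat (2 * k + l - 5)"
proof -
  define m where "m = k - 2"
  \<comment> \<open>The three runs take consecutive blocks of naturals as values, of sizes
    \<open>k - 2\<close>, \<open>l - 1\<close>, \<open>k - 2\<close>, in total
    \<open>2 * k + l - 5\<close>.\<close>
  define L where "L = map real [0..<m]"
  define M where "M = rev (map real [m..<m + (l - 1)])"
  define U where "U = map real [m + (l - 1)..<m + (l - 1) + m]"
  have inc: "sorted_wrt (<) (map real [a..<b])" for a b
    by (simp add: sorted_wrt_map)
  have "semisaturated k l (L @ M @ U)"
  proof (rule semisaturated_if_extendable)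
    show "distinct (L @ M @ U)"
      by (auto simp: L_def M_def U_def distinct_map)
    show "subseq M (L @ M @ U)"
      by (intro list_emb_append2 list_emb_prefix) simp
    show "sorted_wrt (>) M" "length M = l - 1"
      using inc by (auto simp: M_def sorted_wrt_rev)
    fix q assume q: "q \<in> set M"
    then have sq: "subseq [q] M" by (simp add: subseq_singleton_left)
    have "subseq (L @ [q] @ []) (L @ M @ U)" "subseq ([] @ [q] @ U) (L @ M @ U)"
      using sq by (intro list_emb_append_mono; simp)+
    moreover have "sorted_wrt (<) (L @ [q])" "sorted_wrt (<) (q # U)"
      using q inc by (auto simp: sorted_wrt_append L_def M_def U_def)
    ultimately
    show "\<exists>L'. subseq (L' @ [q]) (L @ M @ U) \<and> sorted_wrt (<) (L' @ [q]) \<and> length L' = k - 2"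
      and "\<exists>U'. subseq (q # U') (L @ M @ U) \<and> sorted_wrt (<) (q # U') \<and> length U' = k - 2"
      by (intro exI[of _ L] exI[of _ U]; simp add: L_def U_def m_def)+
  qed (use assms in auto)
  moreover have "length (L @ M @ U) = 2 * k + l - 5"
    using assms by (simp add: L_def M_def U_def m_def)
  ultimately show ?thesis
    using osat_le by metis
qed

section \<open>Lower bound\<close>

text \<open>In a distinct list the set of values determines a subsequence, so subsequences can be
  intersected and counted as sets.\<close>

lemma subseq_distinct_eq_filter:
  assumes "subseq T S" "distinct S"
  shows "T = filter (\<lambda>x. x \<in> set T) S"
  using assms
proof (induction rule: list_emb.induct)
  case (list_emb_Cons xs ys y)
  then show ?case by (auto dest: subseq_set)
next
  case (list_emb_Cons2 x y xs ys)
  then have "filter (\<lambda>z. z \<in> set (x # xs)) ys = filter (\<lambda>z. z \<in> set xs) ys"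
    by (intro filter_cong) auto
  with list_emb_Cons2 show ?case by auto
qed simp

text \<open>The common values, read in the order of \<open>S\<close>, form a subsequence of both
  \<open>A\<close> and \<open>B\<close>, so they increase and decrease at once.\<close>

lemma card_inter_inc_dec_le_1:
  fixes A B S :: "'a::linorder list"
  assumes "distinct S" "subseq A S" "subseq B S" "sorted_wrt (<) A" "sorted_wrt (>) B"
  shows "card (set A \<inter> set B) \<le> 1"
proof -
  define C where "C = filter (\<lambda>x. x \<in> set A \<inter> set B) S"
  have "C = filter (\<lambda>x. x \<in> set B) A"
    by (subst subseq_distinct_eq_filter[OF assms(2,1)]) (simp add: C_def conj_commute cong: conj_cong)
  then have C: "set C = set A \<inter> set B" "sorted_wrt (<) C"
    using assms(4) by (auto simp: sorted_wrt_filter)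
  have "C = filter (\<lambda>x. x \<in> set A) B"
    by (subst subseq_distinct_eq_filter[OF assms(3,1)]) (simp add: C_def conj_commute)
  then have "sorted_wrt (>) C"
    using assms(5) by (auto simp: sorted_wrt_filter)
  with C(2) have "length C \<le> 1"
    by (cases C rule: remdups_adj.cases) auto
  then show ?thesis
    using card_length[of C] C(1) by simp
qed

text \<open>Inclusion-exclusion: as \<open>B \<inter> C \<subseteq> A\<close>, the term for
  \<open>B \<inter> C\<close> cancels the triple one, leaving two overlaps of size at most
  one.\<close>

lemma card_three_sets:
  assumes "finite A" "finite B" "finite C"
    and "card (A \<inter> B) \<le> 1" "card (A \<inter> C) \<le> 1" "B \<inter> C \<subseteq> A"
  shows "card A + card B + card C \<le> card (A \<union> B \<union> C) + 2"
proof -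
  have "card B + card C = card (B \<union> C) + card (B \<inter> C)"
    using assms by (intro card_Un_Int) auto
  moreover have "card A + card (B \<union> C) = card (A \<union> (B \<union> C)) + card (A \<inter> (B \<union> C))"
    using assms by (intro card_Un_Int) auto
  moreover have "card (A \<inter> B) + card (A \<inter> C) = card (A \<inter> B \<union> A \<inter> C) + card (A \<inter> B \<inter> (A \<inter> C))"
    using assms by (intro card_Un_Int) auto
  moreover have "A \<inter> B \<inter> (A \<inter> C) = B \<inter> C" "A \<inter> B \<union> A \<inter> C = A \<inter> (B \<union> C)" "A \<union> (B \<union> C) = A \<union> B \<union> C"
    using assms(6) by auto
  ultimately show ?thesis using assms(4,5) by simp
qed

lemma exists_gap_above:
  fixes q :: real
  assumes "finite X"
  shows "\<exists>y>q. \<forall>x\<in>X. x \<le> q \<or> y < x"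
  using assms
proof induction
  case empty
  then show ?case using gt_ex by auto
next
  case (insert a X)
  then obtain y where y: "y > q" "\<forall>x\<in>X. x \<le> q \<or> y < x" by blast
  show ?case
  proof (cases "a \<le> q")
    case False
    then show ?thesis
      using y by (intro exI[of _ "min y ((q + a) / 2)"]) (auto simp: min_less_iff_disj)
  qed (use y in auto)
qed

text \<open>The new monotone sequence must use \<open>y\<close>, which comes first; its tail is the
  required \<open>T\<close>.\<close>

lemma semisaturated_Cons:
  assumes "semisaturated k l S" "y \<notin> set S"
  shows "(\<exists>T. subseq T S \<and> sorted_wrt (<) T \<and> length T = k - 1 \<and> (\<forall>t\<in>set T. y < t)) \<or>
    (\<exists>T. subseq T S \<and> sorted_wrt (>) T \<and> length T = l - 1 \<and> (\<forall>t\<in>set T. t < y))"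
proof -
  have "distinct (y # S)" "strict_subseq S (y # S)"
    using assms by (auto simp: semisaturated_def strict_subseq_def)
  then obtain T where T: "subseq T (y # S)" "\<not> subseq T S"
    "sorted_wrt (<) T \<and> length T = k \<or> sorted_wrt (>) T \<and> length T = l"
    using assms(1) unfolding semisaturated_def by blast
  then obtain T' where "T = y # T'" "subseq T' S"
    by (cases T) (auto simp: subseq_Cons2_iff split: if_splits)
  with T(3) show ?thesis by auto
qed

text \<open>\<open>q\<close> is the greatest minimum of an increasing subsequence of length
  \<open>k - 1\<close>. A point inserted at the left just above \<open>q\<close> has no such
  sequence above it, hence a decreasing one of length \<open>l - 1\<close> below it, with all
  entries at most \<open>q\<close>.\<close>

lemma semisaturated_threshold:
  assumes S: "semisaturated k l S" and kl: "2 \<le> k" "2 \<le> l"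
  obtains q A B where
    "subseq A S" "sorted_wrt (<) A" "length A = k - 1" "q \<in> set A" "\<And>t. t \<in> set A \<Longrightarrow> q \<le> t"
    "subseq B S" "sorted_wrt (>) B" "length B = l - 1" "\<And>t. t \<in> set B \<Longrightarrow> t \<le> q"
proof -
  define P where "P q A \<longleftrightarrow> subseq A S \<and> sorted_wrt (<) A \<and> length A = k - 1 \<and>
    q \<in> set A \<and> (\<forall>t\<in>set A. q \<le> t)" for q A
  have hdP: "P (hd A) A" if "subseq A S" "sorted_wrt (<) A" "length A = k - 1" for A
    using that kl by (cases A) (auto simp: P_def)
  define Q where "Q = {q. \<exists>A. P q A}"
  have "Q \<subseteq> set S"
    by (auto simp: Q_def P_def dest: subseq_set)
  then have fin: "finite Q" by (rule finite_subset) simp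
  \<comment> \<open>No sequence of positive length \<open>l - 1\<close> lies below this
    \<open>y\<close>, so an increasing one lies above it and \<open>Q\<close> is nonempty. For empty
    \<open>S\<close>, \<open>Min\<close> is unspecified but the bound is vacuous.\<close>
  define y where "y = Min (set S) - 1"
  have y: "\<forall>x\<in>set S. y < x"
  proof
    fix x assume "x \<in> set S"
    then have "Min (set S) \<le> x" by simp
    then show "y < x" by (simp add: y_def)
  qed
  have "\<not> (\<forall>t\<in>set T. t < y)" if "subseq T S" "length T = l - 1" for T
    using that y kl subseq_set[of T S] by (cases T) (auto dest: order_less_asym)
  moreover have "y \<notin> set S" using y by auto
  ultimately obtain A0 where "subseq A0 S" "sorted_wrt (<) A0" "length A0 = k - 1"
    using semisaturated_Cons[OF S] by metis
  then have "Q \<noteq> {}" using hdP by (auto simp: Q_def)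
  then have q: "Max Q \<in> Q" using fin by simp
  then obtain A where A: "P (Max Q) A" by (auto simp: Q_def)
  obtain z where z: "z > Max Q" "\<forall>x\<in>set S. x \<le> Max Q \<or> z < x"
    using exists_gap_above[of "set S"] by blast
  have "\<not> (\<forall>t\<in>set T. z < t)" if "subseq T S" "sorted_wrt (<) T" "length T = k - 1" for T
  proof
    assume "\<forall>t\<in>set T. z < t"
    moreover have "hd T \<in> set T" using that kl by (intro hd_in_set) auto
    moreover have "hd T \<le> Max Q" using hdP[OF that] fin by (intro Max_ge) (auto simp: Q_def)
    ultimately show False using z(1) by fastforce
  qed
  moreover have "z \<notin> set S" using z by auto
  ultimately obtain B where B: "subseq B S" "sorted_wrt (>) B" "length B = l - 1" "\<forall>t\<in>set B. t < z"
    using semisaturated_Cons[OF S] by metis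
  have "t \<le> Max Q" if "t \<in> set B" for t
    using that B z(2) by (metis subseq_set subsetD order_less_asym)
  with A B show thesis
    by (intro that[of A "Max Q" B]) (auto simp: P_def)
qed

lemma semisaturated_length_ge:
  assumes S: "semisaturated k l S" and kl: "2 \<le> k" "2 \<le> l"
  shows "min (2 * k + l - 5) (2 * l + k - 5) \<le> length S"
proof -
  have dist: "distinct S" using S by (simp add: semisaturated_def)
  have sub: "set T \<subseteq> set S" "card (set T) = length T" if "subseq T S" for T
    using that dist subseq_set[OF that] subseq_distinct_eq_filter[OF that dist]
    by (auto intro!: distinct_card) (metis distinct_filter)
  obtain q A B where A: "subseq A S" "sorted_wrt (<) A" "length A = k - 1" "q \<in> set A"
      "\<And>t. t \<in> set A \<Longrightarrow> q \<le> t"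
    and B: "subseq B S" "sorted_wrt (>) B" "length B = l - 1" "\<And>t. t \<in> set B \<Longrightarrow> t \<le> q"
    using semisaturated_threshold[OF S kl] by metis
  \<comment> \<open>Reversal turns the sweep at the left into one at the right: \<open>C'\<close>
    increases in \<open>rev S\<close>, so \<open>C\<close> decreases in \<open>S\<close>.\<close>
  obtain q' C' D' where "subseq C' (rev S)" "sorted_wrt (<) C'" "length C' = l - 1"
      "\<And>t. t \<in> set C' \<Longrightarrow> q' \<le> t"
    and "subseq D' (rev S)" "sorted_wrt (>) D'" "length D' = k - 1" "\<And>t. t \<in> set D' \<Longrightarrow> t \<le> q'"
    using semisaturated_threshold[OF semisaturated_rev[OF S] kl(2,1)] by metis
  moreover define C D where "C = rev C'" and "D = rev D'"
  ultimately have C: "subseq C S" "sorted_wrt (>) C" "length C = l - 1" "\<And>t. t \<in> set C \<Longrightarrow> q' \<le> t"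
    and D: "subseq D S" "sorted_wrt (<) D" "length D = k - 1" "\<And>t. t \<in> set D \<Longrightarrow> t \<le> q'"
    by (simp_all add: subseq_rev_iff sorted_wrt_rev)
  note inter = card_inter_inc_dec_le_1[OF dist]
  show ?thesis
  proof (cases "q \<le> q'")
    case True
    \<comment> \<open>A common point satisfies \<open>t \<le> q \<le> q' \<le> t\<close>, so it is
      \<open>q\<close>, an entry of \<open>A\<close>. The count becomes
      \<open>(k - 1) + 2 * (l - 1) - 2\<close>.\<close>
    have "set B \<inter> set C \<subseteq> set A"
    proof
      fix t assume "t \<in> set B \<inter> set C"
      then have "t \<le> q" "q' \<le> t" using B(4) C(4) by auto
      with True have "t = q" by linarith
      with A(4) show "t \<in> set A" by simp
    qed
    with inter[OF A(1) B(1) A(2) B(2)] inter[OF A(1) C(1) A(2) C(2)]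
    have "card (set A) + card (set B) + card (set C) \<le> card (set A \<union> set B \<union> set C) + 2"
      by (intro card_three_sets) simp_all
    also have "card (set A \<union> set B \<union> set C) \<le> card (set S)"
      using sub(1)[OF A(1)] sub(1)[OF B(1)] sub(1)[OF C(1)] by (intro card_mono) auto
    finally show ?thesis
      using sub(2)[OF A(1)] sub(2)[OF B(1)] sub(2)[OF C(1)] A(3) B(3) C(3)
        distinct_card[OF dist] kl by linarith
  next
    case False
    \<comment> \<open>Here \<open>A\<close> and \<open>D\<close> are disjoint: a common
      \<open>t\<close> would give \<open>q \<le> t \<le> q'\<close>.\<close>
    then have "set A \<inter> set D \<subseteq> set B"
      using A(5) D(4) by fastforce
    with inter[OF A(1) B(1) A(2) B(2)] inter[OF D(1) B(1) D(2) B(2)]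
    have "card (set B) + card (set A) + card (set D) \<le> card (set B \<union> set A \<union> set D) + 2"
      by (intro card_three_sets) (simp_all add: Int_commute)
    also have "card (set B \<union> set A \<union> set D) \<le> card (set S)"
      using sub(1)[OF A(1)] sub(1)[OF B(1)] sub(1)[OF D(1)] by (intro card_mono) auto
    finally show ?thesis
      using sub(2)[OF A(1)] sub(2)[OF B(1)] sub(2)[OF D(1)] A(3) B(3) D(3)
        distinct_card[OF dist] kl by linarith
  qed
qed

theorem theorem6:
  shows "(\<forall>k l :: nat. 1 \<le> k \<and> 1 \<le> l \<longrightarrow> osat 1 l = 0 \<and> osat k 1 = 0) \<and>
    (\<forall>k l :: nat. 2 \<le> k \<and> 2 \<le> l \<longrightarrow> osat k l = enat (min (2 * k + l - 5) (2 * l + k - 5)))"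
proof (intro conjI allI impI)
  fix k l :: nat
  show "osat 1 l = 0" by (rule osat_1_left)
  show "osat k 1 = 0"
    using osat_commute_le[of k 1] osat_1_left[of k] by simp
next
  fix k l :: nat assume kl: "2 \<le> k \<and> 2 \<le> l"
  have "osat k l \<le> enat (2 * k + l - 5)" "osat k l \<le> enat (2 * l + k - 5)"
    using osat_upper[of k l] osat_upper[of l k] osat_commute_le[of k l] kl by auto
  moreover have "enat (min (2 * k + l - 5) (2 * l + k - 5)) \<le> osat k l"
    unfolding osat_def using kl semisaturated_length_ge by (intro INF_greatest) auto
  ultimately show "osat k l = enat (min (2 * k + l - 5) (2 * l + k - 5))"
    by (intro antisym) (auto simp: min_def)
qed

end
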